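(* Let $\mathcal{F}$ be a family of locally injective meromorphic functions on $\mathbb{C}$. Let $D$ be the domain of normality of $\mathcal{F}$. Then $D$ is contained in the domain of normality of the corresponding family of Schwarzian derivatives $\{S_f:f\in\mathcal{F}\}$ if the limit function of $\mathcal{F}$ on $D$ is locally injective.
   Context: A family of meromorphic functions is normal on an open set $U\subset\mathbb{C}$ if every sequence in the family has a subsequence converging locally uniformly on $U$ with respect to the spherical metric (the limit function $\infty$ being allowed). The domain of normality of a family of meromorphic functions on $\mathbb{C}$ is the largest open subset of $\mathbb{C}$ on which the family is normal. The limit function of $\mathcal{F}$ on $D$ means the (single) function on $D$ to which the family $\mathcal{F}$ converges locally uniformly on $D$. A meromorphic function is locally injective if each point has a neighborhood on which it is injective as a map into the Riemann sphere. The Schwarzian derivative of a meromorphic function $f$ is $S_f(z)=\frac{f'''(z)}{f'(z)}-\frac{3}{2}\left(\frac{f''(z)}{f'(z)}\right)^2$. *)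

theory Defs
  imports
    "HOL-Complex_Analysis.Complex_Analysis"
    "HOL-Library.Diagonal_Subsequence"
begin

text \<open>
  Points of the Riemann sphere are values of type \<^typ>\<open>complex option\<close>, with \<^term>\<open>None\<close> for the
  point at infinity. The map below is inverse stereographic projection onto the unit sphere
  of the Euclidean space \<^typ>\<open>complex \<times> real\<close>; the spherical metric is the great-circle distance.
\<close>

fun stereo :: "complex option \<Rightarrow> complex \<times> real" where
  "stereo None = (0, 1)"
| "stereo (Some z) = ((2 / (1 + (cmod z)\<^sup>2)) *\<^sub>R z, ((cmod z)\<^sup>2 - 1) / ((cmod z)\<^sup>2 + 1))"

definition spherical_dist :: "complex option \<Rightarrow> complex option \<Rightarrow> real" where
  "spherical_dist p q = arccos (stereo p \<bullet> stereo q)"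

text \<open>
  A meromorphic function on the plane is represented by its unique representative
  \<^term>\<open>f\<close> with \<^prop>\<open>f nicely_meromorphic_on UNIV\<close>, which has the conventional value 0 at its poles.
  The associated map into the sphere sends the poles to infinity instead.
\<close>

definition sphere_map :: "(complex \<Rightarrow> complex) \<Rightarrow> complex \<Rightarrow> complex option" where
  "sphere_map f z = (if is_pole f z then None else Some (f z))"

definition locally_injective_on :: "(complex \<Rightarrow> 'b) \<Rightarrow> complex set \<Rightarrow> bool" where
  "locally_injective_on g U \<longleftrightarrow> (\<forall>z\<in>U. \<exists>V. open V \<and> z \<in> V \<and> V \<subseteq> U \<and> inj_on g V)"

definition locally_uniform_limit ::
    "complex set \<Rightarrow> ('i \<Rightarrow> complex \<Rightarrow> complex option) \<Rightarrow> (complex \<Rightarrow> complex option) \<Rightarrow> 'i filter \<Rightarrow> bool"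
  where
  "locally_uniform_limit U h g A \<longleftrightarrow>
     (\<forall>z\<in>U. \<exists>V. open V \<and> z \<in> V \<and> V \<subseteq> U \<and>
        (\<forall>e>0. \<forall>\<^sub>F i in A. \<forall>w\<in>V. spherical_dist (h i w) (g w) < e))"

text \<open>The limit \<^term>\<open>g\<close> is an arbitrary sphere-valued map, so the constant infinity is allowed.\<close>

definition normal_on :: "(complex \<Rightarrow> complex) set \<Rightarrow> complex set \<Rightarrow> bool" where
  "normal_on F U \<longleftrightarrow>
     (\<forall>s::nat \<Rightarrow> complex \<Rightarrow> complex. range s \<subseteq> F \<longrightarrow>
        (\<exists>r g. strict_mono r \<and> locally_uniform_limit U (\<lambda>n. sphere_map (s (r n))) g sequentially))"

text \<open>That this union is itself normal, hence the largest open set of normality, is proved below.\<close>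

definition domain_of_normality :: "(complex \<Rightarrow> complex) set \<Rightarrow> complex set" where
  "domain_of_normality F = \<Union>{U. open U \<and> normal_on F U}"

text \<open>
  Convergence of the family \<^term>\<open>F\<close> itself (not of its subsequences): locally uniformly on
  \<^term>\<open>D\<close>, all but finitely many members of \<^term>\<open>F\<close> are close to \<^term>\<open>g\<close>. For the set of terms
  of a sequence of distinct functions this is the usual convergence of the sequence.
\<close>

definition limit_function :: "(complex \<Rightarrow> complex) set \<Rightarrow> complex set \<Rightarrow> (complex \<Rightarrow> complex option) \<Rightarrow> bool"
  where
  "limit_function F D g \<longleftrightarrow> locally_uniform_limit D sphere_map g (inf cofinite (principal F))"

text \<open>
  The formula for the Schwarzian derivative has junk values at the poles of \<^term>\<open>f\<close> and at the
  zeros of its derivative; \<^term>\<open>remove_sings\<close> turns it into the meromorphic function it represents.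
\<close>

definition schwarzian :: "(complex \<Rightarrow> complex) \<Rightarrow> complex \<Rightarrow> complex" where
  "schwarzian f = remove_sings (\<lambda>z.
     (deriv ^^ 3) f z / deriv f z - 3 / 2 * ((deriv ^^ 2) f z / deriv f z)\<^sup>2)"


lemma norm_stereo [simp]: "norm (stereo p) = 1"
proof (cases p)
  case (Some z)
  define t where "t = (cmod z)\<^sup>2"
  have t: "t \<ge> 0" by (simp add: t_def)
  have "(norm (stereo p))\<^sup>2 = (2 / (1 + t))\<^sup>2 * t + ((t - 1) / (t + 1))\<^sup>2"
    by (simp add: Some norm_Pair power_mult_distrib t_def power_divide)
  also have "\<dots> = 1"
  proof -
    have "1 + t \<noteq> 0" using t by auto
    then show ?thesis
      by (simp add: power_divide add.commute[of t 1] divide_simps)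
         (simp add: power2_eq_square algebra_simps)
  qed
  finally show ?thesis
    by (metis norm_ge_zero one_power2 power2_eq_iff_nonneg zero_le_one)
qed (simp add: norm_Pair)

lemma inj_stereo: "inj stereo"
proof (rule injI)
  fix p q assume eq: "stereo p = stereo q"
  have pos: "(cmod z)\<^sup>2 + 1 \<noteq> 0" "1 + (cmod z)\<^sup>2 \<noteq> 0" for z
    by (smt (verit) zero_le_power2)+
  show "p = q"
  proof (cases p; cases q)
    fix z w assume pq: "p = Some z" "q = Some w"
    have "((cmod z)\<^sup>2 - 1) / ((cmod z)\<^sup>2 + 1) = ((cmod w)\<^sup>2 - 1) / ((cmod w)\<^sup>2 + 1)"
      using eq pq by simp
    then have "(cmod z)\<^sup>2 = (cmod w)\<^sup>2"
      using pos[of z] pos[of w] by (simp add: divide_simps) (simp add: algebra_simps)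
    with eq pq pos show ?thesis by simp
  qed (use eq pos in \<open>auto simp: divide_simps\<close>)
qed

text \<open>Convergence in the spherical and in the chordal metric agree.\<close>

lemma dist_stereo_sq: "(dist (stereo p) (stereo q))\<^sup>2 = 2 - 2 * (stereo p \<bullet> stereo q)"
  using dot_norm_neg[of "stereo p" "stereo q"] by (simp add: dist_norm)

lemma inner_stereo_bounds: "\<bar>stereo p \<bullet> stereo q\<bar> \<le> 1"
  using Cauchy_Schwarz_ineq2[of "stereo p" "stereo q"] by simp

lemma dist_stereo_eq: "dist (stereo p) (stereo q) = 2 * sin (spherical_dist p q / 2)"
proof -
  define t where "t = spherical_dist p q"
  have t: "0 \<le> t" "t \<le> pi" and c: "cos t = stereo p \<bullet> stereo q"
    using inner_stereo_bounds[of p q] unfolding t_def spherical_dist_def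
    by (auto simp: arccos_lbound arccos_ubound cos_arccos_abs)
  have "cos t = 1 - 2 * (sin (t / 2))\<^sup>2"
    using cos_double_sin[of "t / 2"] by simp
  then have "(dist (stereo p) (stereo q))\<^sup>2 = (2 * sin (t / 2))\<^sup>2"
    using c by (simp add: dist_stereo_sq power_mult_distrib)
  moreover have "0 \<le> sin (t / 2)" using t by (intro sin_ge_zero) auto
  ultimately show ?thesis
    unfolding t_def by - (rule power2_eq_imp_eq, simp_all)
qed

lemma spherical_dist_bounds: "0 \<le> spherical_dist p q" "spherical_dist p q \<le> pi"
  using inner_stereo_bounds[of p q] unfolding spherical_dist_def
  by (auto simp: arccos_lbound arccos_ubound)

lemma spherical_dist_less_iff:
  assumes "0 \<le> e" "e \<le> pi"
  shows "spherical_dist p q < e \<longleftrightarrow> dist (stereo p) (stereo q) < 2 * sin (e / 2)"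
  using assms spherical_dist_bounds[of p q]
  by (subst dist_stereo_eq) (simp add: sin_mono_less_eq)

lemma uniform_spherical_iff:
  "(\<forall>e>0. \<forall>\<^sub>F i in A. \<forall>w\<in>V. spherical_dist (h i w) (g w) < e) \<longleftrightarrow>
   uniform_limit V (\<lambda>i w. stereo (h i w)) (\<lambda>w. stereo (g w)) A"
proof
  assume L: "\<forall>e>0. \<forall>\<^sub>F i in A. \<forall>w\<in>V. spherical_dist (h i w) (g w) < e"
  show "uniform_limit V (\<lambda>i w. stereo (h i w)) (\<lambda>w. stereo (g w)) A"
  proof (rule uniform_limitI)
    fix e :: real assume "e > 0"
    with L have "\<forall>\<^sub>F i in A. \<forall>w\<in>V. spherical_dist (h i w) (g w) < e" by blast
    then show "\<forall>\<^sub>F i in A. \<forall>w\<in>V. dist (stereo (h i w)) (stereo (g w)) < e"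
    proof (rule eventually_mono, intro ballI)
      fix i w assume "\<forall>w\<in>V. spherical_dist (h i w) (g w) < e" "w \<in> V"
      then show "dist (stereo (h i w)) (stereo (g w)) < e"
        using sin_x_le_x[of "spherical_dist (h i w) (g w) / 2"] spherical_dist_bounds(1)[of "h i w" "g w"]
        by (auto simp: dist_stereo_eq)
    qed
  qed
next
  assume R: "uniform_limit V (\<lambda>i w. stereo (h i w)) (\<lambda>w. stereo (g w)) A"
  show "\<forall>e>0. \<forall>\<^sub>F i in A. \<forall>w\<in>V. spherical_dist (h i w) (g w) < e"
  proof (intro allI impI)
    fix e :: real assume "e > 0"
    define d where "d = min e pi"
    have d: "0 < d" "d \<le> pi" "d \<le> e" using \<open>e > 0\<close> by (auto simp: d_def)
    have "0 < 2 * sin (d / 2)" using d by (simp add: sin_gt_zero)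
    from uniform_limitD[OF R this]
    show "\<forall>\<^sub>F i in A. \<forall>w\<in>V. spherical_dist (h i w) (g w) < e"
      by (rule eventually_mono)
         (use d spherical_dist_less_iff[of d] in \<open>force intro: order.strict_trans2\<close>)
  qed
qed

lemma locally_uniform_limit_iff:
  "locally_uniform_limit U h g A \<longleftrightarrow>
     (\<forall>z\<in>U. \<exists>V. open V \<and> z \<in> V \<and> V \<subseteq> U \<and>
        uniform_limit V (\<lambda>i w. stereo (h i w)) (\<lambda>w. stereo (g w)) A)"
  by (simp add: locally_uniform_limit_def uniform_spherical_iff)

lemma locally_uniform_limit_filter:
  assumes "locally_uniform_limit U h g A" "filterlim r A B"
  shows "locally_uniform_limit U (\<lambda>i. h (r i)) g B"
  using assms(1) eventually_compose_filterlim[OF _ assms(2)]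
  unfolding locally_uniform_limit_def by meson

lemma limit_function_range:
  fixes s :: "nat \<Rightarrow> complex \<Rightarrow> complex"
  assumes "inj s"
  shows "limit_function (range s) D g \<longleftrightarrow>
           locally_uniform_limit D (\<lambda>n. sphere_map (s n)) g sequentially"
proof -
  have "(\<forall>\<^sub>F f in inf cofinite (principal (range s)). P f) \<longleftrightarrow> (\<forall>\<^sub>F n in sequentially. P (s n))" for P
  proof -
    have "{f. \<not> (f \<in> range s \<longrightarrow> P f)} = s ` {n. \<not> P (s n)}" by auto
    then have "(\<forall>\<^sub>F f in inf cofinite (principal (range s)). P f) \<longleftrightarrow> finite {n. \<not> P (s n)}"
      using assms unfolding eventually_inf_principal eventually_cofinite
      by (metis (mono_tags, lifting) finite_image_iff inj_on_subset subset_UNIV)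
    then show ?thesis
      by (simp add: eventually_cofinite flip: cofinite_eq_sequentially)
  qed
  then show ?thesis
    by (simp add: limit_function_def locally_uniform_limit_def)
qed

lemma open_domain_of_normality: "open (domain_of_normality F)"
  unfolding domain_of_normality_def by auto

lemma domain_of_normality_maximal:
  "open U \<Longrightarrow> normal_on F U \<Longrightarrow> U \<subseteq> domain_of_normality F"
  unfolding domain_of_normality_def by auto

lemma normal_on_domain_of_normality: "normal_on F (domain_of_normality F)"
proof -
  let ?C = "{U. open U \<and> normal_on F U}"
  obtain C where C: "C \<subseteq> ?C" "countable C" "\<Union>C = \<Union>?C"
    using Lindelof[of ?C] by auto
  have "normal_on F {}"
    by (auto simp: normal_on_def locally_uniform_limit_def intro: exI[of _ id] strict_mono_id)
  then have C': "insert {} C \<subseteq> ?C" using C by auto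
  define W where "W = from_nat_into (insert {} C)"
  have rW: "range W = insert {} C"
    unfolding W_def using C(2) by (intro range_from_nat_into) auto
  have W: "normal_on F (W n)" for n using C' rW by blast
  have D: "domain_of_normality F = (\<Union>n. W n)"
    unfolding domain_of_normality_def C(3)[symmetric] rW by simp
  show ?thesis
    unfolding normal_on_def
  proof (intro allI impI)
    fix s :: "nat \<Rightarrow> complex \<Rightarrow> complex" assume s: "range s \<subseteq> F"
    define P where "P n r \<longleftrightarrow>
      (\<exists>g. locally_uniform_limit (W n) (\<lambda>k. sphere_map (s (r k))) g sequentially)" for n and r :: "nat \<Rightarrow> nat"
    interpret subseqs P
    proof
      fix n and r :: "nat \<Rightarrow> nat" assume "strict_mono r"
      have "range (s \<circ> r) \<subseteq> F" using s by auto
      then show "\<exists>r'. strict_mono r' \<and> P n (r \<circ> r')"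
        using W[of n] unfolding normal_on_def P_def by fastforce
    qed
    have "P n diagseq" for n
    proof -
      have "P n (diagseq \<circ> ((+) (Suc n)))"
      proof (rule diagseq_holds)
        fix r t :: "nat \<Rightarrow> nat" and k assume "strict_mono r" "P k t"
        then show "P k (t \<circ> r)"
          unfolding P_def
          using locally_uniform_limit_filter[OF _ filterlim_subseq, of "W k" _ _ r] by fastforce
      qed
      then obtain g where g:
        "locally_uniform_limit (W n) (\<lambda>k. sphere_map (s (diagseq (Suc n + k)))) g sequentially"
        by (auto simp: P_def)
      have shift: "(\<forall>\<^sub>F k in sequentially. Q (diagseq (Suc n + k))) \<longleftrightarrow> (\<forall>\<^sub>F k in sequentially. Q (diagseq k))"
        for Q :: "nat \<Rightarrow> bool"
        using eventually_sequentially_seg[of "\<lambda>k. Q (diagseq k)" "Suc n"] by (simp only: add.commute)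
      have "locally_uniform_limit (W n) (\<lambda>k. sphere_map (s (diagseq k))) g sequentially"
        unfolding locally_uniform_limit_def
      proof
        fix z assume "z \<in> W n"
        obtain V where V: "open V" "z \<in> V" "V \<subseteq> W n" and lim:
          "\<forall>e>0. \<forall>\<^sub>F k in sequentially.
             \<forall>w\<in>V. spherical_dist (sphere_map (s (diagseq (Suc n + k))) w) (g w) < e"
          using g[unfolded locally_uniform_limit_def, rule_format, OF \<open>z \<in> W n\<close>] by (elim exE conjE)
        have "\<forall>\<^sub>F k in sequentially. \<forall>w\<in>V. spherical_dist (sphere_map (s (diagseq k)) w) (g w) < e"
          if "e > 0" for e
          using lim[rule_format, OF that]
            shift[of "\<lambda>m. \<forall>w\<in>V. spherical_dist (sphere_map (s m) w) (g w) < e"] by (rule iffD1[rotated])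
        with V show "\<exists>V. open V \<and> z \<in> V \<and> V \<subseteq> W n \<and>
          (\<forall>e>0. \<forall>\<^sub>F k in sequentially. \<forall>w\<in>V. spherical_dist (sphere_map (s (diagseq k)) w) (g w) < e)"
          by (intro exI[of _ V]) simp
      qed
      then show ?thesis by (auto simp: P_def)
    qed
    then have "\<forall>n. \<exists>g. locally_uniform_limit (W n) (\<lambda>k. sphere_map (s (diagseq k))) g sequentially"
      by (simp only: P_def simp_thms)
    from choice[OF this] obtain G where G:
      "\<forall>n. locally_uniform_limit (W n) (\<lambda>k. sphere_map (s (diagseq k))) (G n) sequentially"
      by (elim exE)
    have lim: "(\<lambda>k. stereo (sphere_map (s (diagseq k)) z)) \<longlonglongrightarrow> stereo (G n z)" if zW: "z \<in> W n" for n z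
    proof -
      obtain V where V: "z \<in> V" and
        u: "uniform_limit V (\<lambda>k w. stereo (sphere_map (s (diagseq k)) w)) (\<lambda>w. stereo (G n w)) sequentially"
        using G[rule_format, of n, unfolded locally_uniform_limit_iff, rule_format, OF zW] by (elim exE conjE)
      show ?thesis using tendsto_uniform_limitI[OF u V] .
    qed
    have eq: "G n z = G m z" if "z \<in> W n" "z \<in> W m" for n m z
      using LIMSEQ_unique[OF lim[OF that(1)] lim[OF that(2)]] inj_stereo by (simp add: inj_eq)
    define g where "g z = G (LEAST n. z \<in> W n) z" for z
    have g: "g z = G n z" if "z \<in> W n" for n z
      unfolding g_def using that by (intro eq) (auto intro: LeastI)
    have "locally_uniform_limit (domain_of_normality F) (\<lambda>k. sphere_map (s (diagseq k))) g sequentially"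
      unfolding locally_uniform_limit_def
    proof
      fix z assume "z \<in> domain_of_normality F"
      then obtain n where n: "z \<in> W n" using D by auto
      with G[rule_format, of n] obtain V where V: "open V" "z \<in> V" "V \<subseteq> W n"
        "\<forall>e>0. \<forall>\<^sub>F k in sequentially. \<forall>w\<in>V. spherical_dist (sphere_map (s (diagseq k)) w) (G n w) < e"
        unfolding locally_uniform_limit_def by blast
      have "\<forall>e>0. \<forall>\<^sub>F k in sequentially. \<forall>w\<in>V. spherical_dist (sphere_map (s (diagseq k)) w) (g w) < e"
      proof -
        have "g w = G n w" if "w \<in> V" for w using V(3) that by (intro g) auto
        then show ?thesis using V(4) by (simp cong: ball_cong)
      qed
      moreover have "V \<subseteq> domain_of_normality F" using V(3) D by auto
      ultimately show "\<exists>V. open V \<and> z \<in> V \<and> V \<subseteq> domain_of_normality F \<and>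
         (\<forall>e>0. \<forall>\<^sub>F k in sequentially. \<forall>w\<in>V. spherical_dist (sphere_map (s (diagseq k)) w) (g w) < e)"
        using V(1,2) by (intro exI[of _ V]) simp
    qed
    then show "\<exists>r g. strict_mono r \<and>
        locally_uniform_limit (domain_of_normality F) (\<lambda>n. sphere_map (s (r n))) g sequentially"
      using subseq_diagseq by (intro exI conjI)
  qed
qed

end

theory Submission
  imports Defs
begin

text \<open>
  Near a point where the limit is finite, the functions converge uniformly as holomorphic
  functions to an injective limit. Its derivative has no zeros, so by Cauchy's estimates the
  Schwarzian derivatives converge uniformly as well. Near a point where the limit is infinite, the
  same applies to the reciprocals, which have the same Schwarzian derivatives.
\<close>

section \<open>Uniform limits of holomorphic functions\<close>

text \<open>Holomorphy is local, so it suffices to apply Weierstrass's theorem on a closed disc in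
  \<open>V\<close> around each point.\<close>

lemma uniform_limit_holomorphic:
  fixes f :: "'i \<Rightarrow> complex \<Rightarrow> complex"
  assumes "open V" "uniform_limit V f h A" "\<forall>\<^sub>F i in A. f i holomorphic_on V" "A \<noteq> bot"
  shows "h holomorphic_on V"
proof -
  have "h field_differentiable at z" if "z \<in> V" for z
  proof -
    obtain r where r: "r > 0" "cball z r \<subseteq> V"
      using \<open>open V\<close> \<open>z \<in> V\<close> open_contains_cball by blast
    have "h holomorphic_on ball z r"
    proof (rule holomorphic_uniform_limit)
      show "\<forall>\<^sub>F i in A. continuous_on (cball z r) (f i) \<and> f i holomorphic_on ball z r"
        using assms(3)
      proof eventually_elim
        case (elim i)
        then show ?case
          using r ball_subset_cball[of z r]
          by (meson holomorphic_on_imp_continuous_on holomorphic_on_subset order_trans)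
      qed
      show "uniform_limit (cball z r) f h A"
        using assms(2) r(2) by (rule uniform_limit_on_subset)
    qed (use assms in auto)
    then show ?thesis
      using r(1) holomorphic_on_imp_differentiable_at by fastforce
  qed
  then show ?thesis
    using \<open>open V\<close> by (simp add: holomorphic_on_open field_differentiable_def)
qed

text \<open>Cauchy's estimate is applied to \<open>f i - h\<close> on discs centred in
  \<open>K\<close>. Compactness of \<open>K\<close> provides one radius for which all these discs
  lie in \<open>V\<close>.\<close>

lemma uniform_limit_higher_deriv:
  fixes f :: "'i \<Rightarrow> complex \<Rightarrow> complex"
  assumes "open V" "uniform_limit V f h A" and ev: "\<forall>\<^sub>F i in A. f i holomorphic_on V"
    and "A \<noteq> bot" "compact K" "K \<subseteq> V"
  shows "uniform_limit K (\<lambda>i. (deriv ^^ n) (f i)) ((deriv ^^ n) h) A"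
proof (rule uniform_limitI)
  fix e :: real assume "e > 0"
  have h: "h holomorphic_on V"
    using assms by (intro uniform_limit_holomorphic)
  obtain d where d: "d > 0" "(\<Union>x\<in>K. ball x d) \<subseteq> V"
    using compact_subset_open_imp_ball_epsilon_subset[OF \<open>compact K\<close> \<open>open V\<close> \<open>K \<subseteq> V\<close>] .
  \<comment> \<open>Halving the radius makes the closed discs fit into the open ones.\<close>
  define r where "r = d / 2"
  have r: "r > 0" using d by (simp add: r_def)
  have sub: "cball w r \<subseteq> V" if "w \<in> K" for w
  proof -
    have "cball w r \<subseteq> ball w d" using d(1) by (auto simp: r_def)
    then show ?thesis using d(2) that by blast
  qed
  \<comment> \<open>With this bound on \<open>f i - h\<close>, Cauchy's estimate gives exactly
    \<open>e / 2\<close>, which leaves room for the strict inequality.\<close>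
  define B where "B = e * r ^ n / (2 * fact n)"
  have "B > 0" using r \<open>e > 0\<close> by (simp add: B_def)
  from uniform_limitD[OF assms(2) this] ev
  show "\<forall>\<^sub>F i in A. \<forall>w\<in>K. dist ((deriv ^^ n) (f i) w) ((deriv ^^ n) h w) < e"
  proof eventually_elim
    case (elim i)
    show ?case
    proof
      fix w assume w: "w \<in> K"
      define k where "k = (\<lambda>u. f i u - h u)"
      have k: "k holomorphic_on V"
        unfolding k_def using elim h by (intro holomorphic_intros)
      have "norm ((deriv ^^ n) k w) \<le> fact n * B / r ^ n"
      proof (rule Cauchy_inequality)
        show "k holomorphic_on ball w r"
          by (rule holomorphic_on_subset[OF k]) (use sub[OF w] in auto)
        show "continuous_on (cball w r) k"
          using k sub[OF w] holomorphic_on_imp_continuous_on holomorphic_on_subset by blast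
        fix u assume "norm (w - u) = r"
        then have "u \<in> V" using sub[OF w] by (auto simp: dist_norm subset_iff)
        then show "norm (k u) \<le> B"
          using elim(1) by (force simp: k_def dist_norm)
      qed (rule r)
      also have "\<dots> = e / 2"
        using r by (simp add: B_def)
      finally have "norm ((deriv ^^ n) k w) < e" using \<open>e > 0\<close> by simp
      moreover have "(deriv ^^ n) k w = (deriv ^^ n) (f i) w - (deriv ^^ n) h w"
        unfolding k_def using elim(2) h \<open>open V\<close> w \<open>K \<subseteq> V\<close> by (intro higher_deriv_diff[where S = V]) auto
      ultimately show "dist ((deriv ^^ n) (f i) w) ((deriv ^^ n) h w) < e"
        by (simp add: dist_norm)
    qed
  qed
qed

section \<open>Schwarzian derivatives\<close>

text \<open>The expression under \<open>remove_sings\<close> in \<open>schwarzian\<close>, named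
  separately because it can be computed pointwise wherever \<open>f\<close> is holomorphic with
  nonzero derivative.\<close>

definition schwarzian_formula :: "(complex \<Rightarrow> complex) \<Rightarrow> complex \<Rightarrow> complex" where
  "schwarzian_formula f z =
     (deriv ^^ 3) f z / deriv f z - 3 / 2 * ((deriv ^^ 2) f z / deriv f z)\<^sup>2"

lemma schwarzian_eq: "schwarzian f = remove_sings (schwarzian_formula f)"
  by (simp add: schwarzian_def schwarzian_formula_def [abs_def])

lemma holomorphic_on_schwarzian_formula:
  assumes "f holomorphic_on V" "open V" "\<And>w. w \<in> V \<Longrightarrow> deriv f w \<noteq> 0"
  shows "schwarzian_formula f holomorphic_on V"
  unfolding schwarzian_formula_def
  using assms by (intro holomorphic_intros holomorphic_higher_deriv holomorphic_deriv) auto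

text \<open>The formula is analytic at \<open>z\<close>, and \<open>remove_sings\<close> keeps the
  value of a function at such a point.\<close>

lemma schwarzian_eq_formula:
  assumes "f holomorphic_on V" "open V" "\<And>w. w \<in> V \<Longrightarrow> deriv f w \<noteq> 0" "z \<in> V"
  shows "schwarzian f z = schwarzian_formula f z"
  using holomorphic_on_schwarzian_formula[OF assms(1-3)] assms(2,4)
  unfolding schwarzian_eq by (intro remove_sings_at_analytic) (auto simp: analytic_at)

text \<open>Ensures that \<open>sphere_map\<close> takes the finite value of the Schwarzian
  derivative on \<open>V\<close>.\<close>

lemma not_is_pole_schwarzian:
  assumes "f holomorphic_on V" "open V" "\<And>w. w \<in> V \<Longrightarrow> deriv f w \<noteq> 0" "z \<in> V"
  shows "\<not> is_pole (schwarzian f) z"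
proof (rule not_is_pole_holomorphic)
  show "schwarzian f holomorphic_on V"
    using holomorphic_on_schwarzian_formula[OF assms(1-3)] schwarzian_eq_formula[OF assms(1-3)]
    by (simp cong: holomorphic_cong)
qed (use assms in auto)

section \<open>Invariance of the Schwarzian derivative under reciprocals\<close>

text \<open>A special case of Moebius invariance, checked by computing three derivatives of the
  reciprocal.\<close>

lemma schwarzian_formula_inverse:
  assumes f: "f holomorphic_on V" "open V" "z \<in> V"
    and nz: "\<And>w. w \<in> V \<Longrightarrow> f w \<noteq> 0" "deriv f z \<noteq> 0"
  shows "schwarzian_formula (\<lambda>w. inverse (f w)) z = schwarzian_formula f z"
proof -
  define f1 f2 f3 where "f1 = deriv f" and "f2 = deriv f1" and "f3 = deriv f2"
  have h: "f1 holomorphic_on V" "f2 holomorphic_on V"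
    using f by (auto simp: f1_def f2_def intro!: holomorphic_deriv)
  have d: "(f has_field_derivative f1 w) (at w)" "(f1 has_field_derivative f2 w) (at w)"
    "(f2 has_field_derivative f3 w) (at w)" if "w \<in> V" for w
    using f(1) h f(2) that unfolding f1_def f2_def f3_def by (auto intro: holomorphic_derivI)
  define g where "g = (\<lambda>w. inverse (f w))"
  \<comment> \<open>\<open>g1\<close>, \<open>g2\<close>, \<open>g3\<close> are the successive
    derivatives of \<open>g\<close>, each obtained from the previous one by the product rule and
    \<open>g1 = - f1 * g ^ 2\<close>.\<close>
  define g1 where "g1 = (\<lambda>w. - f1 w * g w ^ 2)"
  define g2 where "g2 = (\<lambda>w. - f2 w * g w ^ 2 + 2 * f1 w ^ 2 * g w ^ 3)"
  define g3 where "g3 = (\<lambda>w. - f3 w * g w ^ 2 + 6 * f1 w * f2 w * g w ^ 3 - 6 * f1 w ^ 3 * g w ^ 4)"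
  have dg: "(g has_field_derivative g1 w) (at w)" if "w \<in> V" for w
    using DERIV_inverse_fun[OF d(1)[OF that] nz(1)[OF that]]
    by (simp add: g_def g1_def eval_nat_numeral mult_ac)
  then have D1: "deriv g w = g1 w" if "w \<in> V" for w using that by (blast intro: DERIV_imp_deriv)
  have "(g1 has_field_derivative g2 w) (at w)" if "w \<in> V" for w
    unfolding g1_def
    by (rule derivative_eq_intros d dg that refl)+
      (simp add: g1_def g2_def eval_nat_numeral algebra_simps)
  then have "deriv g1 w = g2 w" if "w \<in> V" for w using that by (blast intro: DERIV_imp_deriv)
  \<comment> \<open>\<open>deriv g\<close> and \<open>g1\<close> agree on an open set around
    \<open>w\<close>, so their derivatives at \<open>w\<close> agree.\<close>
  moreover have "deriv (deriv g) w = deriv g1 w" if "w \<in> V" for w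
    by (rule deriv_cong_ev) (use f(2) that D1 in \<open>auto simp: eventually_nhds\<close>)
  ultimately have D2: "deriv (deriv g) w = g2 w" if "w \<in> V" for w using that by simp
  have "(g2 has_field_derivative g3 z) (at z)"
    unfolding g2_def
    by (rule derivative_eq_intros d dg f(3) refl)+
      (simp add: g1_def g3_def eval_nat_numeral algebra_simps)
  then have "deriv g2 z = g3 z" by (rule DERIV_imp_deriv)
  moreover have "deriv (deriv (deriv g)) z = deriv g2 z"
    by (rule deriv_cong_ev) (use f(2,3) D2 in \<open>auto simp: eventually_nhds\<close>)
  ultimately have D3: "deriv (deriv (deriv g)) z = g3 z" by simp
  have "f1 z \<noteq> 0" "g z \<noteq> 0"
    using nz f(3) by (auto simp: f1_def g_def)
  then have q: "g3 z / g1 z = f3 z / f1 z - 6 * f2 z * g z + 6 * f1 z ^ 2 * g z ^ 2"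
    "g2 z / g1 z = f2 z / f1 z - 2 * f1 z * g z"
    by (simp_all add: g1_def g2_def g3_def field_simps eval_nat_numeral)
  have "schwarzian_formula g z = g3 z / g1 z - 3 / 2 * (g2 z / g1 z)\<^sup>2"
    using D1[OF f(3)] D2[OF f(3)] D3
    by (simp add: schwarzian_formula_def numeral_3_eq_3 numeral_2_eq_2)
  \<comment> \<open>Expanding the square produces
    \<open>- 6 * f2 z * g z + 6 * f1 z ^ 2 * g z ^ 2\<close> after multiplication by 3/2; these are
    the extra terms of \<open>g3 z / g1 z\<close>, so they cancel.\<close>
  also have "\<dots> = f3 z / f1 z - 3 / 2 * (f2 z / f1 z)\<^sup>2"
    using \<open>f1 z \<noteq> 0\<close> unfolding q power2_diff by (simp add: field_simps power2_eq_square)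
  also have "\<dots> = schwarzian_formula f z"
    by (simp add: schwarzian_formula_def numeral_3_eq_3 numeral_2_eq_2 f1_def f2_def f3_def)
  finally show ?thesis by (simp add: g_def)
qed

text \<open>\<open>remove_sings\<close> depends only on a punctured neighbourhood of each point, so
  the two formulas need to agree only there. Injectivity makes \<open>f\<close> have nonzero
  derivative and at most one zero on such a neighbourhood.\<close>

lemma schwarzian_inverse:
  assumes nm: "f nicely_meromorphic_on UNIV" and inj: "locally_injective_on (sphere_map f) UNIV"
  shows "schwarzian (\<lambda>w. inverse (f w)) = schwarzian f"
proof
  fix z
  obtain V where V: "open V" "z \<in> V" "inj_on (sphere_map f) V"
    using inj unfolding locally_injective_on_def by blast
  have "isolated_singularity_at f z"
    using nm by (auto simp: nicely_meromorphic_on_def meromorphic_on_altdef)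
  then obtain r where r: "r > 0" "f analytic_on ball z r - {z}"
    by (auto simp: isolated_singularity_at_def)
  define W where "W = (V \<inter> ball z r) - {z}"
  have W: "open W" "f holomorphic_on W"
    using V(1) r(2) by (auto simp: W_def intro!: open_delete analytic_imp_holomorphic
      intro: analytic_on_subset)
  have sm: "sphere_map f w = Some (f w)" if "w \<in> W" for w
    using not_is_pole_holomorphic[OF W(1) that W(2)] by (simp add: sphere_map_def)
  have injW: "inj_on f W"
    using V(3) sm by (auto simp: inj_on_def W_def)
  have evW: "\<forall>\<^sub>F w in at z. w \<in> W"
    unfolding eventually_at_topological W_def using V r(1)
    by (intro exI[of _ "V \<inter> ball z r"]) auto
  \<comment> \<open>By injectivity there is at most one zero \<open>u\<close> in \<open>W\<close>,
    and points close enough to \<open>z\<close> avoid it.\<close>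
  have nz: "\<forall>\<^sub>F w in at z. f w \<noteq> 0"
  proof (cases "\<exists>u\<in>W. f u = 0")
    case True
    then obtain u where u: "u \<in> W" "f u = 0" by blast
    have "\<forall>\<^sub>F w in at z. w \<noteq> u"
      by (rule eventually_neq_at_within)
    with evW show ?thesis
      by eventually_elim (use u injW in \<open>auto simp: inj_on_def\<close>)
  qed (use evW in \<open>auto elim: eventually_mono\<close>)
  have "\<forall>\<^sub>F w in at z. schwarzian_formula (\<lambda>w. inverse (f w)) w = schwarzian_formula f w"
    using evW nz
  proof eventually_elim
    case (elim w)
    have op: "open {v \<in> W. f v \<noteq> 0}"
    proof -
      have "open (W \<inter> f -` (- {0}))"
        using W by (intro continuous_open_preimage holomorphic_on_imp_continuous_on) auto
      also have "W \<inter> f -` (- {0}) = {v \<in> W. f v \<noteq> 0}" by auto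
      finally show ?thesis .
    qed
    show ?case
    proof (rule schwarzian_formula_inverse[OF _ op])
      show "f holomorphic_on {v \<in> W. f v \<noteq> 0}"
        by (rule holomorphic_on_subset[OF W(2)]) auto
      show "deriv f w \<noteq> 0"
        using holomorphic_injective_imp_regular[OF W(2,1) injW elim(1)] .
    qed (use elim in auto)
  qed
  then show "schwarzian (\<lambda>w. inverse (f w)) z = schwarzian f z"
    unfolding schwarzian_eq by (intro remove_sings_cong) auto
qed

section \<open>Uniform convergence of Schwarzian derivatives\<close>

text \<open>An injective holomorphic limit has a derivative bounded away from zero on a compact
  disc, so the quotients in the formula converge uniformly there. Boundedness of the limit and
  absence of poles serve to carry the convergence to the sphere.\<close>

lemma uniform_limit_schwarzian:
  fixes f :: "'i \<Rightarrow> complex \<Rightarrow> complex"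
  assumes "open V" "uniform_limit V f h A" and ev: "\<forall>\<^sub>F i in A. f i holomorphic_on V"
    and "A \<noteq> bot" "inj_on h V" "z \<in> V"
  obtains W k where "open W" "z \<in> W" "W \<subseteq> V" "bounded (k ` W)"
    "uniform_limit W (\<lambda>i. schwarzian (f i)) k A"
    "\<forall>\<^sub>F i in A. \<forall>w\<in>W. \<not> is_pole (schwarzian (f i)) w"
proof -
  obtain r where r: "r > 0" "cball z r \<subseteq> V"
    using \<open>open V\<close> \<open>z \<in> V\<close> open_contains_cball by blast
  define K where "K = cball z r"
  have K: "compact K" "K \<subseteq> V" "z \<in> K" using r by (auto simp: K_def)
  have h: "h holomorphic_on V" using assms by (intro uniform_limit_holomorphic)
  have cont: "continuous_on K ((deriv ^^ n) h)" for n
    using h \<open>open V\<close> K(2) holomorphic_higher_deriv holomorphic_on_imp_continuous_on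
      continuous_on_subset by blast
  have dnz: "deriv h w \<noteq> 0" if "w \<in> V" for w
    using holomorphic_injective_imp_regular[OF h \<open>open V\<close> \<open>inj_on h V\<close> that] .
  obtain w0 where w0: "w0 \<in> K" "\<And>w. w \<in> K \<Longrightarrow> norm (deriv h w0) \<le> norm (deriv h w)"
    using continuous_attains_inf[OF K(1), of "\<lambda>w. norm (deriv h w)"] K(3) cont[of 1]
    by (auto intro: continuous_on_norm)
  \<comment> \<open>The minimum of the modulus of \<open>deriv h\<close> on \<open>K\<close>,
    positive because \<open>h\<close> is injective.\<close>
  define b where "b = norm (deriv h w0)"
  have b: "b > 0" using dnz w0 K by (auto simp: b_def)
  have lim: "uniform_limit K (\<lambda>i. (deriv ^^ n) (f i)) ((deriv ^^ n) h) A" for n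
    using assms K by (intro uniform_limit_higher_deriv)
  have bd: "bounded ((deriv ^^ n) h ` K)" for n
    using compact_continuous_image[OF cont K(1)] compact_imp_bounded by blast
  have quot: "uniform_limit K (\<lambda>i w. (deriv ^^ n) (f i) w / deriv (f i) w)
      (\<lambda>w. (deriv ^^ n) h w / deriv h w) A" for n
    using uniform_lim_divide[OF lim[of n] lim[of 1] bd, of b] b w0(2) by (simp add: b_def)
  have contq: "continuous_on K (\<lambda>w. (deriv ^^ n) h w / deriv h w)" for n
    using cont[of n] cont[of 1] dnz K(2) by (intro continuous_on_divide) auto
  have bdK: "bounded (u ` K)" if "continuous_on K u" for u :: "complex \<Rightarrow> complex"
    using that K(1) compact_continuous_image compact_imp_bounded by blast
  have S: "uniform_limit K (\<lambda>i. schwarzian_formula (f i)) (schwarzian_formula h) A"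
    unfolding schwarzian_formula_def[abs_def] power2_eq_square
    by (intro uniform_limit_intros uniform_lim_mult quot bdK continuous_intros contq)
  \<comment> \<open>A zero of \<open>deriv (f i)\<close> in \<open>K\<close> would be at distance at
    least \<open>b\<close> from the value of \<open>deriv h\<close> there.\<close>
  have "\<forall>\<^sub>F i in A. \<forall>w\<in>K. deriv (f i) w \<noteq> 0"
    using uniform_limitD[OF lim[of 1] b]
  proof eventually_elim
    case (elim i)
    then show ?case using w0(2) by (fastforce simp: b_def dist_norm)
  qed
  with ev have good: "\<forall>\<^sub>F i in A. \<forall>w\<in>ball z r.
      schwarzian (f i) w = schwarzian_formula (f i) w \<and> \<not> is_pole (schwarzian (f i)) w"
  proof eventually_elim
    case (elim i)
    have "f i holomorphic_on ball z r" "\<And>w. w \<in> ball z r \<Longrightarrow> deriv (f i) w \<noteq> 0"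
      using elim K(2) by (auto simp: K_def elim!: holomorphic_on_subset)
    then show ?case
      using schwarzian_eq_formula[of "f i" "ball z r"] not_is_pole_schwarzian[of "f i" "ball z r"]
      by simp
  qed
  show ?thesis
  proof (rule that[of "ball z r" "schwarzian_formula h"])
    show "bounded (schwarzian_formula h ` ball z r)"
    proof (rule bounded_subset)
      have "continuous_on K (schwarzian_formula h)"
        using holomorphic_on_schwarzian_formula[OF h \<open>open V\<close> dnz] K(2)
          holomorphic_on_imp_continuous_on continuous_on_subset by blast
      then show "bounded (schwarzian_formula h ` K)"
        using K(1) compact_continuous_image compact_imp_bounded by blast
    qed (auto simp: K_def)
    have "uniform_limit (ball z r) (\<lambda>i. schwarzian_formula (f i)) (schwarzian_formula h) A"
      using S by (rule uniform_limit_on_subset) (auto simp: K_def)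
    then show "uniform_limit (ball z r) (\<lambda>i. schwarzian (f i)) (schwarzian_formula h) A"
      by (rule uniform_limit_cong[THEN iffD1, rotated 2]) (use good in \<open>auto elim: eventually_mono\<close>)
    show "\<forall>\<^sub>F i in A. \<forall>w\<in>ball z r. \<not> is_pole (schwarzian (f i)) w"
      using good by (rule eventually_mono) blast
  qed (use r in \<open>auto simp: K_def\<close>)
qed

section \<open>Spherical convergence\<close>

fun sphere_inverse :: "complex option \<Rightarrow> complex option" where
  "sphere_inverse None = Some 0"
| "sphere_inverse (Some z) = (if z = 0 then None else Some (inverse z))"

lemma inj_sphere_inverse: "inj sphere_inverse"
proof -
  have "sphere_inverse (sphere_inverse p) = p" for p by (cases p) auto
  then show ?thesis by (metis injI)
qed

text \<open>On the unit sphere, inversion is the half-turn about the real axis; in particular it is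
  an isometry.\<close>

lemma stereo_sphere_inverse:
  "stereo (sphere_inverse p) = (cnj (fst (stereo p)), - snd (stereo p))"
proof (cases p)
  case (Some z)
  show ?thesis
  proof (cases "z = 0")
    case False
    define t where "t = (cmod z)\<^sup>2"
    have t: "t > 0" using False by (simp add: t_def)
    \<comment> \<open>In this form the factor \<open>1 / t\<close> merges with the scaling factor of
      \<open>stereo\<close>.\<close>
    have i: "inverse z = (1 / t) *\<^sub>R cnj z"
      unfolding t_def
      using complex_div_cnj[of 1 z] by (simp add: scaleR_conv_of_real inverse_eq_divide)
    have n: "(cmod (inverse z))\<^sup>2 = 1 / t"
      by (simp add: t_def norm_inverse power_inverse divide_inverse)
    have eqs: "2 / (1 + 1 / t) * (1 / t) = 2 / (1 + t)" "(1 / t - 1) / (1 / t + 1) = - ((t - 1) / (t + 1))"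
      using t by (simp_all add: divide_simps)
    have "stereo (Some (inverse z)) = ((2 / (1 + t)) *\<^sub>R cnj z, - ((t - 1) / (t + 1)))"
      unfolding stereo.simps n unfolding i scaleR_scaleR eqs ..
    with False show ?thesis by (simp add: Some t_def)
  qed (simp add: Some)
qed simp

text \<open>Three cases: at a pole the reciprocal has a removable singularity with value 0, at a
  zero it has a pole, and elsewhere it is analytic.\<close>

lemma sphere_map_inverse:
  assumes nm: "f nicely_meromorphic_on UNIV" and inj: "locally_injective_on (sphere_map f) UNIV"
  shows "sphere_map (\<lambda>w. inverse (f w)) z = sphere_inverse (sphere_map f z)"
proof (cases "is_pole f z")
  case True
  then have "(\<lambda>w. inverse (f w)) \<midarrow>z\<rightarrow> 0"
    using is_pole_tendsto by (fastforce simp: comp_def)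
  then have "\<not> is_pole (\<lambda>w. inverse (f w)) z"
    unfolding is_pole_def using at_neq_bot not_tendsto_and_filterlim_at_infinity by blast
  \<comment> \<open>By the convention for values at poles, \<open>inverse (f z)\<close> is
    \<open>inverse 0 = 0\<close>, which is the correct value of the reciprocal.\<close>
  moreover have "f z = 0"
    using True nm at_neq_bot not_tendsto_and_filterlim_at_infinity
    unfolding nicely_meromorphic_on_def is_pole_def by blast
  ultimately show ?thesis using True by (simp add: sphere_map_def)
next
  case False
  have an: "f analytic_on {z}"
    using nicely_meromorphic_on_imp_analytic_at[OF nm _ False] by simp
  show ?thesis
  proof (cases "f z = 0")
    case True
    obtain W where W: "open W" "z \<in> W" "f holomorphic_on W" using an analytic_at by blast
    obtain V where V: "open V" "z \<in> V" "inj_on (sphere_map f) V"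
      using inj unfolding locally_injective_on_def by blast
    have sm: "sphere_map f w = Some (f w)" if "w \<in> W" for w
      using not_is_pole_holomorphic[OF W(1) that W(3)] by (simp add: sphere_map_def)
    \<comment> \<open>Local injectivity isolates the zero, which excludes that \<open>f\<close>
      vanishes identically.\<close>
    have "\<forall>\<^sub>F w in at z. f w \<noteq> 0"
      unfolding eventually_at_topological
    proof (intro exI[of _ "V \<inter> W"] conjI ballI impI)
      fix w assume w: "w \<in> V \<inter> W" "w \<noteq> z"
      then have "sphere_map f w \<noteq> sphere_map f z"
        using V(2,3) by (auto simp: inj_on_def)
      then show "f w \<noteq> 0" using sm w W(2) True by auto
    qed (use V W in auto)
    moreover have "f \<midarrow>z\<rightarrow> 0"
      using analytic_at_imp_isCont[OF an] True by (simp add: isCont_def)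
    ultimately have "is_pole (\<lambda>w. inverse (f w)) z"
      unfolding is_pole_def by (intro filterlim_compose[OF filterlim_inverse_at_infinity])
        (auto simp: filterlim_at)
    then show ?thesis using False True by (simp add: sphere_map_def)
  next
    case nz: False
    have "(\<lambda>w. inverse (f w)) analytic_on {z}"
      using an nz by (intro analytic_on_inverse) auto
    then have "\<not> is_pole (\<lambda>w. inverse (f w)) z"
      by (meson analytic_at not_is_pole_holomorphic)
    then show ?thesis using False nz by (simp add: sphere_map_def)
  qed
qed

section \<open>Passing between spherical and Euclidean uniform convergence\<close>

text \<open>The quotient is stereographic projection from the north pole.\<close>

lemma stereo_Some_inverse:
  "fst (stereo (Some z)) / of_real (1 - snd (stereo (Some z))) = z"
proof -
  define t where "t = (cmod z)\<^sup>2"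
  have t: "t \<ge> 0" by (simp add: t_def)
  then have "1 - (t - 1) / (t + 1) = 2 / (1 + t)" by (simp add: field_simps)
  moreover have "1 + complex_of_real t \<noteq> 0" using t by (auto simp: complex_eq_iff)
  ultimately show ?thesis by (simp add: t_def[symmetric] scaleR_conv_of_real)
qed

lemma continuous_on_stereo_Some: "continuous_on UNIV (\<lambda>z. stereo (Some z))"
proof -
  have "1 + (cmod z)\<^sup>2 \<noteq> 0" "(cmod z)\<^sup>2 + 1 \<noteq> 0" for z
    by (smt (verit) zero_le_power2)+
  then show ?thesis by (auto intro!: continuous_intros)
qed

text \<open>The parameter \<open>c\<close> keeps all values away from the point at infinity, where \<open>snd (stereo p) = 1\<close>.\<close>

lemma uniform_limit_from_stereo:
  assumes lim: "uniform_limit V (\<lambda>i w. stereo (Some (f i w))) (\<lambda>w. stereo (Some (h w))) A"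
    and ev: "\<forall>\<^sub>F i in A. \<forall>w\<in>V. snd (stereo (Some (f i w))) \<le> c" and "c < 1"
  shows "uniform_limit V f h A"
proof -
  \<comment> \<open>A compact set containing the relevant values; on it the denominator
    \<open>1 - snd p\<close> is at least \<open>1 - c\<close>, so the projection is uniformly
    continuous.\<close>
  define B :: "(complex \<times> real) set" where "B = cball 0 1 \<inter> {p. snd p \<le> c}"
  have "closed {p :: complex \<times> real. snd p \<le> c}"
    by (intro closed_Collect_le continuous_intros)
  then have B: "compact B" unfolding B_def by (intro compact_Int_closed) auto
  have "continuous_on B (\<lambda>p. fst p / complex_of_real (1 - snd p))"
    using \<open>c < 1\<close> by (intro continuous_intros) (auto simp: B_def simp flip: of_real_diff)
  then have uc: "uniformly_continuous_on B (\<lambda>p. fst p / complex_of_real (1 - snd p))"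
    using B by (rule compact_uniformly_continuous)
  have "\<forall>\<^sub>F i in A. \<forall>w\<in>V. stereo (Some (f i w)) \<in> B"
    using ev by (rule eventually_mono) (simp add: B_def del: stereo.simps)
  from uniform_limit_compose_uniformly_continuous_on[OF lim uc this compact_imp_closed[OF B]]
  show ?thesis by (simp only: stereo_Some_inverse)
qed

text \<open>Boundedness of \<open>h\<close> keeps all values, eventually, in one compact disc, on
  which \<open>stereo\<close> is uniformly continuous. The radius \<open>M + 1\<close> allows an
  error of 1.\<close>

lemma uniform_limit_to_stereo:
  assumes lim: "uniform_limit V f h A" and bd: "bounded (h ` V)"
  shows "uniform_limit V (\<lambda>i w. stereo (Some (f i w))) (\<lambda>w. stereo (Some (h w))) A"
proof -
  obtain M where M: "\<And>w. w \<in> V \<Longrightarrow> norm (h w) \<le> M"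
    using bd by (auto simp: bounded_iff)
  have "uniformly_continuous_on (cball 0 (M + 1)) (\<lambda>z. stereo (Some z))"
    by (intro compact_uniformly_continuous continuous_on_subset[OF continuous_on_stereo_Some]) auto
  then show ?thesis
  proof (rule uniform_limit_compose_uniformly_continuous_on[OF lim])
    show "\<forall>\<^sub>F i in A. \<forall>w\<in>V. f i w \<in> cball 0 (M + 1)"
      using uniform_limitD[OF lim, of 1, simplified]
    proof eventually_elim
      case (elim i)
      show ?case
      proof
        fix w assume "w \<in> V"
        with elim M[of w] norm_triangle_ineq2[of "f i w" "h w"] show "f i w \<in> cball 0 (M + 1)"
          by (fastforce simp: dist_norm)
      qed
    qed
  qed simp
qed

section \<open>Schwarzian derivatives of a spherically convergent family\<close>

text \<open>A single \<open>f i\<close> close to \<open>g\<close> is continuous and stays away from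
  infinity near \<open>z\<close>. By closeness \<open>g\<close> then does so too, and hence
  eventually all the functions do.\<close>

lemma locally_uniform_limit_finite_chart:
  assumes nm: "\<forall>\<^sub>F i in A. f i nicely_meromorphic_on UNIV" and "A \<noteq> bot"
    and V0: "open V0" "z \<in> V0"
      "uniform_limit V0 (\<lambda>i w. stereo (sphere_map (f i) w)) (\<lambda>w. stereo (g w)) A"
    and inj: "inj_on g V0" and gz: "g z = Some a"
  obtains V h where "open V" "z \<in> V" "V \<subseteq> V0" "uniform_limit V f h A" "inj_on h V"
    "\<forall>\<^sub>F i in A. f i holomorphic_on V"
proof -
  \<comment> \<open>The height of \<open>g z\<close> on the sphere; height 1 is attained only at
    infinity.\<close>
  define s where "s = snd (stereo (g z))"
  \<comment> \<open>Three errors \<open>e\<close> will be spent, from \<open>f i\<close> at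
    \<open>z\<close> to \<open>g\<close> to the other functions; \<open>s + 3 * e\<close> is halfway
    between \<open>s\<close> and 1.\<close>
  define e where "e = (1 - s) / 6"
  have "(cmod a)\<^sup>2 + 1 > 0" by (smt (verit) zero_le_power2)
  then have "s < 1" by (simp add: s_def gz)
  then have e: "e > 0" by (simp add: e_def)
  have snd_le: "snd p \<le> snd q + dist p q" for p q :: "complex \<times> real"
    using dist_snd_le[of p q] by (simp add: dist_real_def)
  have pole: "sphere_map k w = Some (k w) \<and> \<not> is_pole k w"
    if "snd (stereo (sphere_map k w)) < 1" for k w
    using that by (auto simp: sphere_map_def split: if_splits)
  note close = uniform_limitD[OF V0(3) e]
  obtain i where i: "f i nicely_meromorphic_on UNIV"
    "\<And>w. w \<in> V0 \<Longrightarrow> dist (stereo (sphere_map (f i) w)) (stereo (g w)) < e"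
    using eventually_happens'[OF \<open>A \<noteq> bot\<close> eventually_conj[OF nm close]] by blast
  have iz: "snd (stereo (sphere_map (f i) z)) < s + e"
    using snd_le[of "stereo (sphere_map (f i) z)" "stereo (g z)"] i(2)[OF V0(2)] by (simp add: s_def)
  moreover have "s + e < 1" using \<open>s < 1\<close> by (simp add: e_def field_simps)
  ultimately have "\<not> is_pole (f i) z" using pole[of "f i" z] by simp
  then obtain W where W: "open W" "z \<in> W" "f i holomorphic_on W"
    using nicely_meromorphic_on_imp_analytic_at[OF i(1)] analytic_at by blast
  have smi: "sphere_map (f i) w = Some (f i w)" if "w \<in> W" for w
    using not_is_pole_holomorphic[OF W(1) that W(3)] by (simp add: sphere_map_def)
  have "continuous_on W (\<lambda>w. snd (stereo (Some (f i w))))"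
    by (intro continuous_on_snd continuous_on_compose2[OF continuous_on_stereo_Some]
        holomorphic_on_imp_continuous_on W(3)) auto
  from continuous_open_preimage[OF this W(1), of "{..< s + e}"]
  have oW: "open {w \<in> W. snd (stereo (Some (f i w))) < s + e}"
    by (simp add: vimage_def Int_def)
  have c: "s + 3 * e < 1" using \<open>s < 1\<close> by (simp add: e_def field_simps)
  define V where "V = V0 \<inter> {w \<in> W. snd (stereo (Some (f i w))) < s + e}"
  have V: "open V" "z \<in> V" "V \<subseteq> V0"
    using oW V0 W(2) iz smi[OF W(2)] by (auto simp: V_def simp del: stereo.simps)
  have gV: "snd (stereo (g w)) < s + 2 * e" if "w \<in> V" for w
    using that snd_le[of "stereo (g w)" "stereo (sphere_map (f i) w)"] i(2)[of w] smi[of w]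
    by (auto simp: V_def dist_commute simp del: stereo.simps)
  \<comment> \<open>On \<open>V\<close> the height of \<open>g\<close> is below 1, so
    \<open>g\<close> is finite there and \<open>the\<close> returns its actual value.\<close>
  define h where "h = (\<lambda>w. the (g w))"
  have gh: "g w = Some (h w)" if "w \<in> V" for w
    using gV[OF that] c e by (cases "g w") (auto simp: h_def simp del: stereo.simps(2))
  have fV: "\<forall>\<^sub>F i in A. \<forall>w\<in>V. snd (stereo (sphere_map (f i) w)) \<le> s + 3 * e"
    using close
  proof eventually_elim
    case (elim i)
    show ?case
    proof
      fix w assume "w \<in> V"
      then show "snd (stereo (sphere_map (f i) w)) \<le> s + 3 * e"
        using elim gV[of w] snd_le[of "stereo (sphere_map (f i) w)" "stereo (g w)"] V(3) by fastforce
    qed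
  qed
  have fS: "\<forall>\<^sub>F i in A. \<forall>w\<in>V. sphere_map (f i) w = Some (f i w) \<and> \<not> is_pole (f i) w"
    using fV by (rule eventually_mono) (use pole c in fastforce)
  show ?thesis
  proof (rule that[OF V])
    show "inj_on h V"
      using inj gh V(3) by (auto simp: inj_on_def subset_iff)
    show "\<forall>\<^sub>F i in A. f i holomorphic_on V"
      using nm fS
    proof eventually_elim
      case (elim i)
      then have "f i analytic_on {w}" if "w \<in> V" for w
        using nicely_meromorphic_on_imp_analytic_at[OF elim(1)] that by simp
      then show ?case
        by (metis analytic_imp_holomorphic analytic_on_analytic_at)
    qed
    show "uniform_limit V f h A"
    proof (rule uniform_limit_from_stereo)
      have "uniform_limit V (\<lambda>i w. stereo (sphere_map (f i) w)) (\<lambda>w. stereo (g w)) A"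
        using V0(3) V(3) by (rule uniform_limit_on_subset)
      then show "uniform_limit V (\<lambda>i w. stereo (Some (f i w))) (\<lambda>w. stereo (Some (h w))) A"
        by (rule uniform_limit_cong[THEN iffD1, rotated 2])
          (use fS gh in \<open>auto elim!: eventually_mono simp del: stereo.simps\<close>)
      show "\<forall>\<^sub>F i in A. \<forall>w\<in>V. snd (stereo (Some (f i w))) \<le> s + 3 * e"
        using fV fS by eventually_elim simp
    qed (rule c)
  qed
qed

text \<open>If \<open>g z\<close> is infinite, the reciprocals take the place of the functions.
  Since \<open>f'\<close> has the same Schwarzian derivatives in both cases, the rest of the
  argument is common to them.\<close>

lemma schwarzian_limit_at_point:
  assumes nm: "\<And>i. f i nicely_meromorphic_on UNIV"
    and li: "\<And>i. locally_injective_on (sphere_map (f i)) UNIV" and "A \<noteq> bot"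
    and V0: "open V0" "z \<in> V0"
      "uniform_limit V0 (\<lambda>i w. stereo (sphere_map (f i) w)) (\<lambda>w. stereo (g w)) A"
    and inj: "inj_on g V0"
  obtains W k where "open W" "z \<in> W" "W \<subseteq> V0"
    "uniform_limit W (\<lambda>i w. stereo (sphere_map (schwarzian (f i)) w)) (\<lambda>w. stereo (Some (k w))) A"
proof -
  have "\<exists>f' V h. open V \<and> z \<in> V \<and> V \<subseteq> V0 \<and> uniform_limit V f' h A \<and> inj_on h V \<and>
    (\<forall>\<^sub>F i in A. f' i holomorphic_on V) \<and> (\<forall>i. schwarzian (f' i) = schwarzian (f i))"
  proof (cases "g z")
    case (Some a)
    obtain V h where "open V" "z \<in> V" "V \<subseteq> V0" "uniform_limit V f h A" "inj_on h V"
      "\<forall>\<^sub>F i in A. f i holomorphic_on V"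
      using locally_uniform_limit_finite_chart[of f A V0 z g a] assms Some by auto
    then show ?thesis by (intro exI[of _ f] exI[of _ V] exI[of _ h]) simp
  next
    case None
    define f' where "f' = (\<lambda>i w. inverse (f i w))"
    define g' where "g' = (\<lambda>w. sphere_inverse (g w))"
    have nm': "f' i nicely_meromorphic_on UNIV" for i
      unfolding f'_def using nm by (rule nicely_meromorphic_on_inverse)
    have inj': "inj_on g' V0"
      using inj inj_sphere_inverse by (auto simp: g'_def inj_on_def inj_def)
    have lim': "uniform_limit V0 (\<lambda>i w. stereo (sphere_map (f' i) w)) (\<lambda>w. stereo (g' w)) A"
    proof (rule uniform_limitI)
      \<comment> \<open>Since inversion is an isometry, uniform convergence passes to the
        reciprocals with the same \<open>e\<close>.\<close>
      have iso: "dist (stereo (sphere_inverse p)) (stereo (sphere_inverse q)) = dist (stereo p) (stereo q)"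
        for p q
        unfolding stereo_sphere_inverse
        by (simp add: dist_prod_def dist_norm flip: complex_cnj_diff) (simp add: power2_commute)
      fix e :: real assume "e > 0"
      from uniform_limitD[OF V0(3) this]
      show "\<forall>\<^sub>F i in A. \<forall>w\<in>V0. dist (stereo (sphere_map (f' i) w)) (stereo (g' w)) < e"
        unfolding f'_def g'_def using nm li by (simp only: sphere_map_inverse iso)
    qed
    obtain V h where "open V" "z \<in> V" "V \<subseteq> V0" "uniform_limit V f' h A" "inj_on h V"
      "\<forall>\<^sub>F i in A. f' i holomorphic_on V"
      using locally_uniform_limit_finite_chart[of f' A V0 z g' 0] nm' inj' lim' assms None
      by (auto simp: g'_def)
    moreover have "schwarzian (f' i) = schwarzian (f i)" for i
      unfolding f'_def using nm li by (rule schwarzian_inverse)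
    ultimately show ?thesis by blast
  qed
  then obtain f' V h where f': "open V" "z \<in> V" "V \<subseteq> V0" "uniform_limit V f' h A" "inj_on h V"
    "\<forall>\<^sub>F i in A. f' i holomorphic_on V" "\<And>i. schwarzian (f' i) = schwarzian (f i)" by blast
  obtain W k where W: "open W" "z \<in> W" "W \<subseteq> V" "bounded (k ` W)"
    "uniform_limit W (\<lambda>i. schwarzian (f' i)) k A"
    "\<forall>\<^sub>F i in A. \<forall>w\<in>W. \<not> is_pole (schwarzian (f' i)) w"
    using uniform_limit_schwarzian[OF f'(1,4,6) \<open>A \<noteq> bot\<close> f'(5,2)] .
  show ?thesis
  proof (rule that[OF W(1,2)])
    have "uniform_limit W (\<lambda>i w. stereo (Some (schwarzian (f i) w))) (\<lambda>w. stereo (Some (k w))) A"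
      using uniform_limit_to_stereo[OF W(5,4)] by (simp only: f'(7))
    then show "uniform_limit W (\<lambda>i w. stereo (sphere_map (schwarzian (f i)) w)) (\<lambda>w. stereo (Some (k w))) A"
      by (rule uniform_limit_cong[THEN iffD1, rotated 2])
        (use W(6) f'(7) in \<open>auto elim!: eventually_mono simp: sphere_map_def simp del: stereo.simps\<close>)
  qed (use W f' in auto)
qed

text \<open>The local limits patch together because each is the pointwise limit, which is
  unique.\<close>

lemma locally_uniform_limit_schwarzian:
  assumes nm: "\<And>i. f i nicely_meromorphic_on UNIV"
    and li: "\<And>i. locally_injective_on (sphere_map (f i)) UNIV" and "A \<noteq> bot"
    and lim: "locally_uniform_limit D (\<lambda>i. sphere_map (f i)) g A"
    and inj: "locally_injective_on g D"
  shows "\<exists>G. locally_uniform_limit D (\<lambda>i. sphere_map (schwarzian (f i))) G A"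
proof -
  \<comment> \<open>Defining \<open>G\<close> by pointwise limits makes it independent of the
    neighbourhoods; on each \<open>W\<close> below it coincides with the local limit
    \<open>k\<close>.\<close>
  define G where "G z = Some (THE k.
    ((\<lambda>i. stereo (sphere_map (schwarzian (f i)) z)) \<longlongrightarrow> stereo (Some k)) A)" for z
  have "\<exists>V. open V \<and> z \<in> V \<and> V \<subseteq> D \<and>
     uniform_limit V (\<lambda>i w. stereo (sphere_map (schwarzian (f i)) w)) (\<lambda>w. stereo (G w)) A"
    if zD: "z \<in> D" for z
  proof -
    obtain V1 where V1: "open V1" "z \<in> V1" "V1 \<subseteq> D"
      "uniform_limit V1 (\<lambda>i w. stereo (sphere_map (f i) w)) (\<lambda>w. stereo (g w)) A"
      using lim[unfolded locally_uniform_limit_iff, rule_format, OF zD] by (elim exE conjE)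
    obtain V2 where V2: "open V2" "z \<in> V2" "inj_on g V2"
      using inj[unfolded locally_injective_on_def, rule_format, OF zD] by (elim exE conjE)
    have "uniform_limit (V1 \<inter> V2) (\<lambda>i w. stereo (sphere_map (f i) w)) (\<lambda>w. stereo (g w)) A"
      using V1(4) by (rule uniform_limit_on_subset) auto
    moreover have "inj_on g (V1 \<inter> V2)" using V2(3) by (rule inj_on_subset) auto
    ultimately obtain W k where W: "open W" "z \<in> W" "W \<subseteq> V1 \<inter> V2"
      "uniform_limit W (\<lambda>i w. stereo (sphere_map (schwarzian (f i)) w)) (\<lambda>w. stereo (Some (k w))) A"
      using schwarzian_limit_at_point[of f A "V1 \<inter> V2" z g] nm li \<open>A \<noteq> bot\<close> V1 V2
      by (auto simp: open_Int)
    have "G w = Some (k w)" if "w \<in> W" for w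
    proof -
      note t = tendsto_uniform_limitI[OF W(4) that]
      have "(THE k. ((\<lambda>i. stereo (sphere_map (schwarzian (f i)) w)) \<longlongrightarrow> stereo (Some k)) A) = k w"
      proof (rule the_equality)
        show "((\<lambda>i. stereo (sphere_map (schwarzian (f i)) w)) \<longlongrightarrow> stereo (Some (k w))) A"
          by (rule t)
      next
        fix l assume "((\<lambda>i. stereo (sphere_map (schwarzian (f i)) w)) \<longlongrightarrow> stereo (Some l)) A"
        from tendsto_unique[OF \<open>A \<noteq> bot\<close> this t] show "l = k w"
          using inj_stereo by (simp add: inj_eq del: stereo.simps)
      qed
      then show ?thesis by (simp add: G_def)
    qed
    then have "uniform_limit W (\<lambda>i w. stereo (sphere_map (schwarzian (f i)) w)) (\<lambda>w. stereo (G w)) A"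
      using W(4) by (simp cong: uniform_limit_cong')
    moreover have "W \<subseteq> D" using W(3) V1(3) by auto
    ultimately show ?thesis using W(1,2) by (intro exI[of _ W] conjI)
  qed
  then have "locally_uniform_limit D (\<lambda>i. sphere_map (schwarzian (f i))) G A"
    unfolding locally_uniform_limit_iff by (rule ballI)
  then show ?thesis by (rule exI[of _ G])
qed

section \<open>Normality of the family of Schwarzian derivatives\<close>

theorem theorem2p10:
  fixes F :: "(complex \<Rightarrow> complex) set"
    and D :: "complex set"
    and g :: "complex \<Rightarrow> complex option"
  assumes "\<And>f. f \<in> F \<Longrightarrow> f nicely_meromorphic_on UNIV"
    and "\<And>f. f \<in> F \<Longrightarrow> locally_injective_on (sphere_map f) UNIV"
    and "D = domain_of_normality F"
    and "limit_function F D g"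
    and "locally_injective_on g D"
  shows "D \<subseteq> domain_of_normality (schwarzian ` F)"
proof (rule domain_of_normality_maximal)
  show "open D" using assms(3) by (simp add: open_domain_of_normality)
  show "normal_on (schwarzian ` F) D"
    unfolding normal_on_def
  proof (intro allI impI)
    fix s :: "nat \<Rightarrow> complex \<Rightarrow> complex" assume "range s \<subseteq> schwarzian ` F"
    then have "\<forall>n. \<exists>f\<in>F. s n = schwarzian f" by auto
    then obtain t where t: "\<And>n. t n \<in> F" "\<And>n. s n = schwarzian (t n)" by metis
    show "\<exists>r G. strict_mono r \<and> locally_uniform_limit D (\<lambda>n. sphere_map (s (r n))) G sequentially"
    \<comment> \<open>Convergence of \<open>F\<close> controls only all but finitely many members,
      so it says nothing about a sequence that keeps repeating one function. In that case a constant
      subsequence is taken instead.\<close>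
    proof (cases "\<exists>f. infinite {n. t n = f}")
      case True
      then obtain f r where r: "strict_mono r" "\<And>n::nat. t (r n) = f"
        using infinite_enumerate by force
      have "spherical_dist p p = 0" for p
        by (simp add: spherical_dist_def dot_square_norm)
      then have "locally_uniform_limit D (\<lambda>n. sphere_map (s (r n))) (sphere_map (schwarzian f)) sequentially"
        unfolding locally_uniform_limit_def t(2) r(2) using \<open>open D\<close> by auto
      with r(1) show ?thesis by blast
    next
      case False
      \<comment> \<open>Each of the finitely many exceptional functions occurs only finitely often.
        Hence \<open>t\<close> eventually leaves every finite subset of \<open>F\<close> and
        inherits the limit \<open>g\<close>.\<close>
      have "finite {n. \<not> P (t n)}" if "finite {f. \<not> (f \<in> F \<longrightarrow> P f)}" for P
      proof -
        have "{n. \<not> P (t n)} = (\<Union>f\<in>{f. \<not> (f \<in> F \<longrightarrow> P f)}. {n. t n = f})"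
          using t(1) by auto
        then show ?thesis using that False by auto
      qed
      then have "filterlim t (inf cofinite (principal F)) sequentially"
        unfolding filterlim_iff eventually_inf_principal eventually_cofinite
        by (simp add: eventually_cofinite flip: cofinite_eq_sequentially)
      with assms(4) have "locally_uniform_limit D (\<lambda>n. sphere_map (t n)) g sequentially"
        unfolding limit_function_def by (rule locally_uniform_limit_filter)
      then obtain G where "locally_uniform_limit D (\<lambda>n. sphere_map (schwarzian (t n))) G sequentially"
        using locally_uniform_limit_schwarzian[of t sequentially D g] assms(1,2,5) t(1) by auto
      then show ?thesis
        \<comment> \<open>Here the whole sequence converges, so the subsequence is given by
          \<open>id\<close>.\<close>
        using strict_mono_id by (intro exI[of _ id] exI[of _ G]) (simp add: t(2))
    qed
  qed
qed

end
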